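(* Let $n>3$ be an odd integer and $k=1$, and let $$g^*_{n,k}(x):=(-k(n-1)+2n)+\sum_{j=1}^{(n-1)/2-1}\Big[k\binom{n-1}{2j+1}-k\binom{n-1}{2j-1}+2\binom{n}{2j}\Big]x^j+(-k(n-1)+2n)x^{(n-1)/2}\in\mathbb{Z}[x],$$ $$C_{n,k}(x):=g^*_{n,k}(x)-(n+1)x^{(n-1)/2}.$$ Then, with $N=(n-1)/2$, $C_{n,1}(x)$ viewed as an element of $\mathbb{Z}[x]/(x^N-1)$ is a coterm polynomial.
   Context: For a commutative ring $R$ with identity and $N\ge1$, a polynomial $a_0+a_1x+\cdots+a_{N-1}x^{N-1}\in R[x]/(x^N-1)$ with $a_i\in R$ is a coterm polynomial if $a_i=a_{N-i}$ for all $1\le i\le\lfloor N/2\rfloor$. Binomial coefficients $\binom{a}{b}$ are $0$ when $b>a$. *)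

theory Defs
  imports "HOL-Algebra.Algebraic_Closure_Type"
begin

text \<open>
  The quotient ring \<open>R[x]/(x^N - 1)\<close>, where \<open>R\<close> is the ring carried by the type \<open>'a\<close>. Its
  elements are cosets of the principal ideal generated by \<open>x^N - 1\<close>.
\<close>

definition cyc_ideal :: "nat \<Rightarrow> 'a::comm_ring_1 poly set" where
  "cyc_ideal N = PIdl\<^bsub>ring_of_type_algebra\<^esub> (Polynomial.monom 1 N - 1)"

definition cyc_ring :: "nat \<Rightarrow> 'a::comm_ring_1 poly set ring" where
  "cyc_ring N = ring_of_type_algebra Quot (cyc_ideal N)"

definition cyc_class :: "nat \<Rightarrow> 'a::comm_ring_1 poly \<Rightarrow> 'a poly set" where
  "cyc_class N p = cyc_ideal N +>\<^bsub>ring_of_type_algebra\<^esub> p"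

text \<open>
  The coefficients \<open>a 0, \<dots>, a (N - 1)\<close> are those of the representative of degree below \<open>N\<close>. For
  \<open>N \<ge> 1\<close> they are determined by the residue class (lemma \<open>cyc_class_sum_eqD\<close> below), so the
  existential quantifier leaves no choice. In \<open>a (N - i)\<close> the index never exceeds \<open>N - 1\<close>, since
  \<open>i \<ge> 1\<close>.
\<close>

definition coterm :: "nat \<Rightarrow> 'a::comm_ring_1 poly set \<Rightarrow> bool" where
  "coterm N s \<longleftrightarrow> s \<in> carrier (cyc_ring N) \<and>
     (\<exists>a. s = cyc_class N (\<Sum>i<N. Polynomial.monom (a i) i) \<and>
          (\<forall>i\<in>{1..N div 2}. a i = a (N - i)))"

definition g_star :: "nat \<Rightarrow> int \<Rightarrow> int poly" where
  "g_star n k =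
     Polynomial.monom (- k * (int n - 1) + 2 * int n) 0
     + (\<Sum>j = 1..(n - 1) div 2 - 1.
          Polynomial.monom
            (k * int ((n - 1) choose (2 * j + 1)) - k * int ((n - 1) choose (2 * j - 1))
             + 2 * int (n choose (2 * j))) j)
     + Polynomial.monom (- k * (int n - 1) + 2 * int n) ((n - 1) div 2)"

definition C_poly :: "nat \<Rightarrow> int \<Rightarrow> int poly" where
  "C_poly n k = g_star n k - Polynomial.monom (int n + 1) ((n - 1) div 2)"

lemma mem_cyc_ideal_iff: "p \<in> cyc_ideal N \<longleftrightarrow> (Polynomial.monom 1 N - 1) dvd p"
  by (auto simp: cyc_ideal_def cgenideal_def ring_of_type_algebra_def dvd_def mult.commute)

lemma mem_cyc_class_iff: "q \<in> cyc_class N p \<longleftrightarrow> (Polynomial.monom 1 N - 1) dvd (q - p)"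
proof -
  have "q \<in> cyc_class N p \<longleftrightarrow> (\<exists>h\<in>cyc_ideal N. q = h + p)"
    by (auto simp: cyc_class_def a_r_coset_def r_coset_def ring_of_type_algebra_def)
  also have "\<dots> \<longleftrightarrow> q - p \<in> cyc_ideal N"
    by (metis add_diff_cancel diff_add_cancel)
  finally show ?thesis by (simp add: mem_cyc_ideal_iff)
qed

lemma cyc_class_in_carrier: "cyc_class N p \<in> carrier (cyc_ring N)"
  by (auto simp: cyc_class_def cyc_ring_def FactRing_def A_RCOSETS_def' a_r_coset_def
      ring_of_type_algebra_def RCOSETS_def A_RCOSETS_def)

lemma cyc_class_sum_eqD:
  fixes a b :: "nat \<Rightarrow> 'a::comm_ring_1"
  assumes eq: "cyc_class N (\<Sum>i<N. Polynomial.monom (a i) i)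
             = cyc_class N (\<Sum>i<N. Polynomial.monom (b i) i)"
    and i: "i < N"
  shows "a i = b i"
proof -
  define d where "d = (\<Sum>i<N. Polynomial.monom (a i) i) - (\<Sum>i<N. Polynomial.monom (b i) i)"
  have d: "Polynomial.coeff d m = (if m < N then a m - b m else 0)" for m
    by (auto simp: d_def coeff_sum)
  have "(Polynomial.monom 1 N - 1) dvd d"
    using eq unfolding d_def mem_cyc_class_iff[symmetric] by (metis mem_cyc_class_iff diff_self dvd_0_right)
  then obtain q where q: "d = Polynomial.monom 1 N * q - q"
    by (auto simp: dvd_def algebra_simps)
  have "q = 0"
  proof (rule ccontr)
    assume "q \<noteq> 0"
    have "Polynomial.coeff d (N + Polynomial.degree q) = Polynomial.lead_coeff q"
      using i by (simp add: q coeff_monom_mult coeff_eq_0)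
    with \<open>q \<noteq> 0\<close> show False by (simp add: d)
  qed
  with d[of i] i show ?thesis by (simp add: q)
qed

end

theory Submission
  imports Defs
begin

text \<open>
  For \<open>k = 1\<close> the leading term of \<open>g_star\<close> cancels against \<open>(n + 1) x^N\<close>, so \<open>C_poly n 1\<close> already
  has degree below \<open>N\<close> and is its own reduced representative. With \<open>m = 2 N\<close>, reflection
  \<open>j \<mapsto> N - j\<close> swaps the two binomials of upper index \<open>m\<close> and replaces \<open>(m + 1) choose (2 j)\<close> by
  \<open>(m + 1) choose (2 j + 1)\<close>; Pascal's rule shows that these changes compensate each other.
\<close>

text \<open>For \<open>0 < j < N\<close>, the coefficient of \<open>x^j\<close> in
  \<open>C_poly (2 * N + 1) 1\<close>. At \<open>j = 0\<close> the index \<open>2 * j - 1\<close>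
  truncates to 0 and the value is \<open>2 * N + 1\<close>, one below the constant
  coefficient.\<close>

definition C_coeff :: "nat \<Rightarrow> nat \<Rightarrow> int" where
  "C_coeff N j = int ((2 * N) choose (2 * j + 1)) - int ((2 * N) choose (2 * j - 1))
     + 2 * int ((2 * N + 1) choose (2 * j))"

lemma C_coeff_reflect:
  assumes "0 < j" "j < N"
  shows "C_coeff N (N - j) = C_coeff N j"
proof -
  obtain i where j: "j = Suc i"
    using assms by (cases j) auto
  have "(2 * N) choose (2 * (N - j) + 1) = (2 * N) choose (2 * j - 1)"
    using assms by (subst binomial_symmetric) (auto simp: algebra_simps)
  moreover have "(2 * N) choose (2 * (N - j) - 1) = (2 * N) choose (2 * j + 1)"
    using assms by (subst binomial_symmetric) (auto simp: algebra_simps)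
  moreover have "(2 * N + 1) choose (2 * (N - j)) = (2 * N + 1) choose (2 * j + 1)"
    using assms by (subst binomial_symmetric) (auto simp: algebra_simps)
  moreover have "(2 * N + 1) choose (2 * j) = (2 * N choose (2 * j)) + (2 * N choose (2 * j - 1))"
    by (simp add: j)
  \<comment> \<open>Pascal at \<open>2 * j + 1\<close> turns both sides into
    \<open>(2N choose (2j-1)) + 2 (2N choose 2j) + (2N choose (2j+1))\<close>.\<close>
  ultimately show ?thesis
    by (simp add: C_coeff_def)
qed

lemma C_poly_1_eq_sum:
  assumes "0 < N"
  shows "C_poly (2 * N + 1) 1 =
    (\<Sum>i<N. Polynomial.monom (if i = 0 then int (2 * N + 2) else C_coeff N i) i)"
proof -
  \<comment> \<open>Splitting off 0 leaves the index range of the sum in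
    \<open>g_star\<close>.\<close>
  have "{..<N} = insert 0 {1..N - 1}"
    using assms by auto
  then show ?thesis
    by (simp add: C_poly_def g_star_def C_coeff_def algebra_simps)
qed

theorem theorem5p6:
  fixes n N :: nat
  assumes "n > 3" and "odd n" and "N = (n - 1) div 2"
  shows "coterm N (cyc_class N (C_poly n 1))"
proof -
  have n: "n = 2 * N + 1" and N: "0 < N"
    using assms by auto
  show ?thesis
    unfolding coterm_def n C_poly_1_eq_sum[OF N]
    by (intro conjI cyc_class_in_carrier
        exI[of _ "\<lambda>i. if i = 0 then int (2 * N + 2) else C_coeff N i"])
      \<comment> \<open>For \<open>1 \<le> i \<le> N div 2\<close> both \<open>i\<close> and
        \<open>N - i\<close> lie strictly between 0 and \<open>N\<close>, so the constant
        coefficient is never compared.\<close>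
      (auto simp: C_coeff_reflect)
qed

end
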